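(* Let $d\ge 1$, let $\Sigma\in\mathbb R^{d\times d}$ be symmetric positive semidefinite, let $\boldsymbol\theta^\circ\in\mathbb R^d$, and let $\mu,\lambda>0$. Assume that $$\|\boldsymbol\theta^\circ\|\le \frac{\mu}{420}\quad\text{and}\quad \|\boldsymbol\theta^\circ\|\,\|\Sigma\|\le\frac{\mu\sqrt\lambda}{168}.$$ Let $(\boldsymbol\theta^*,\boldsymbol\eta^*,A^* )$ be a minimizer over $\mathbb R^d\times\mathbb R^d\times\mathbb R^{d\times d}$ of $$\mathcal L(\boldsymbol\theta,\boldsymbol\eta,A)=\tfrac12\|\Sigma\boldsymbol\theta^\circ-\boldsymbol\eta\|^2+\tfrac12\|\boldsymbol\eta-A\boldsymbol\theta\|^2+\tfrac{\mu^2}{2}\|\Sigma-A\|_{\rm F}^2+\tfrac{\lambda}{2}\|\boldsymbol\theta\|^2 .$$ Then $$\|\boldsymbol\theta^*-\boldsymbol\theta^\circ-\mathbf b_\lambda\|\le 210\left(\frac{\|\boldsymbol\theta^\circ\|}{\mu}+\frac{\|\Sigma\|\,\|\mathbf b_\lambda\|}{\mu\sqrt\lambda}\right)\|\mathbf b_\lambda\|,\qquad\text{where}\quad \mathbf b_\lambda=-\lambda\left(\tfrac12\Sigma^2+\lambda I_d\right)^{-1}\boldsymbol\theta^\circ .$$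
   Context: For vectors $\|\cdot\|$ is the Euclidean norm; for matrices $\|\cdot\|$ is the operator norm and $\|\cdot\|_{\rm F}$ the Frobenius norm. In the paper $\Sigma=\mathbb E\,\mathbf X\mathbf X^\top$ is the (uncentered) second moment matrix of the design vector and $\boldsymbol\theta^\circ$ is the unknown regression vector. *)

theory Defs
  imports "HOL-Analysis.Analysis"
begin

definition sym_psd :: "real^'n^'n \<Rightarrow> bool" where
  "sym_psd S \<longleftrightarrow> transpose S = S \<and> (\<forall>x. x \<bullet> (S *v x) \<ge> 0)"

definition op_norm :: "real^'n^'m \<Rightarrow> real" where
  "op_norm A = onorm (\<lambda>x. A *v x)"

definition frob_norm :: "real^'n^'m \<Rightarrow> real" where
  "frob_norm A = sqrt (\<Sum>i\<in>UNIV. \<Sum>j\<in>UNIV. (A $ i $ j)\<^sup>2)"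

lemma frob_norm_eq_norm: "frob_norm A = norm A"
  by (simp add: frob_norm_def norm_vec_def L2_set_def sum_nonneg)

definition loss ::
  "real^'n^'n \<Rightarrow> real^'n \<Rightarrow> real \<Rightarrow> real \<Rightarrow> real^'n \<Rightarrow> real^'n \<Rightarrow> real^'n^'n \<Rightarrow> real" where
  "loss S \<theta>0 \<mu> lam \<theta> \<eta> A =
     1/2 * (norm (S *v \<theta>0 - \<eta>))\<^sup>2 + 1/2 * (norm (\<eta> - A *v \<theta>))\<^sup>2
     + \<mu>\<^sup>2 / 2 * (frob_norm (S - A))\<^sup>2 + lam / 2 * (norm \<theta>)\<^sup>2"

text \<open>The matrix being inverted is positive definite when \<open>S\<close> is symmetric and \<open>lam > 0\<close>, so
  \<open>matrix_inv\<close>, which is unspecified on singular matrices, is the true inverse there.\<close>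

definition bias :: "real^'n^'n \<Rightarrow> real^'n \<Rightarrow> real \<Rightarrow> real^'n" where
  "bias S \<theta>0 lam =
     - lam *\<^sub>R (matrix_inv ((1/2) *\<^sub>R (S ** S) + lam *\<^sub>R mat 1) *v \<theta>0)"

end

theory Submission
  imports Defs
begin

text \<open>
  The parameters \<open>\<eta>\<close> and \<open>A\<close> can be eliminated from the loss.  At a minimizer \<open>A\<close> differs
  from \<open>S\<close> by a rank-one matrix, and what is left is the profile objective
  \<open>g / 2 * \<parallel>S (\<theta> - \<theta>0)\<parallel>\<^sup>2 + lam / 2 * \<parallel>\<theta>\<parallel>\<^sup>2\<close> with
  \<open>g = 1 / (2 + \<parallel>\<theta>\<parallel>\<^sup>2 / \<mu>\<^sup>2)\<close>.  For large \<open>\<mu>\<close> the weight \<open>g\<close> is close to \<open>1/2\<close>, and with the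
  constant weight \<open>1/2\<close> the problem is ridge regression, whose solution is \<open>\<theta>0 + b\<close> for
  \<open>b = bias S \<theta>0 lam\<close>.  So the theorem is a perturbation bound for the ridge solution.

  Write \<open>e = \<theta> - \<theta>0\<close> and \<open>M = S\<^sup>2 / 2 + lam * I\<close>.  Subtracting the ridge equation
  \<open>M b = - lam * \<theta>0\<close> from the stationarity condition of the profile objective
  (lemma \<open>profile_stationarity\<close>) gives
  \<open>M (e - b) = (1/2 - g) * S\<^sup>2 e + (g\<^sup>2 / \<mu>\<^sup>2) * \<parallel>S e\<parallel>\<^sup>2 * \<theta>\<close>.
  The first term on the right comes from \<open>g\<close> not being \<open>1/2\<close>, the second from \<open>g\<close> depending on
  \<open>\<theta>\<close>.  Since \<open>M\<^sup>-\<^sup>1 S\<^sup>2 / 2\<close> is a contraction and \<open>M\<^sup>-\<^sup>1\<close> has norm at most \<open>1 / lam\<close>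
  (lemma \<open>ridge_perturbation_norm_le\<close>), and since \<open>\<parallel>\<theta>\<parallel> \<le> \<parallel>\<theta>0\<parallel>\<close> by comparing losses
  (lemma \<open>minimizer_norm_le\<close>), \<open>\<parallel>e - b\<parallel>\<close> is bounded by a multiple of \<open>\<parallel>e\<parallel>\<close> plus a multiple of
  \<open>\<parallel>e\<parallel>\<^sup>2\<close> (lemma \<open>deviation_self_bound\<close>).  The smallness assumptions turn this first into
  \<open>\<parallel>e - b\<parallel> \<le> \<parallel>e\<parallel> / 2\<close>, hence \<open>\<parallel>e\<parallel> \<le> 2 * \<parallel>b\<parallel>\<close>; inserting that into the same bound
  gives the theorem.
\<close>

section \<open>First-order conditions\<close>

lemma quadratic_nonneg_imp_linear_coeff_0:
  fixes a q :: real
  assumes "\<And>t. 0 \<le> a * t + q * t\<^sup>2"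
  shows "a = 0"
proof (rule ccontr)
  assume "a \<noteq> 0"
  \<comment> \<open>at \<open>t = - a / k\<close> with \<open>k > q\<close> the linear term wins\<close>
  define k where "k = \<bar>q\<bar> + 1"
  have k: "k > 0" "q - k < 0" by (auto simp: k_def)
  have "a * (- a / k) + q * (- a / k)\<^sup>2 = (a\<^sup>2 / k\<^sup>2) * (q - k)"
    using k by (simp add: field_simps power2_eq_square)
  moreover have "a\<^sup>2 / k\<^sup>2 > 0"
    using \<open>a \<noteq> 0\<close> k by simp
  ultimately show False
    using assms[of "- a / k"] k(2) by (smt (verit) mult_pos_neg)
qed

lemma norm_sq_along_line:
  fixes x y :: "'a::real_inner"
  shows "(norm (x + t *\<^sub>R y))\<^sup>2 = (norm x)\<^sup>2 + 2 * t * (x \<bullet> y) + t\<^sup>2 * (norm y)\<^sup>2"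
  unfolding power2_norm_eq_inner
  by (simp add: inner_add_left inner_add_right inner_commute power2_eq_square algebra_simps)

definition rank_one :: "real^'m \<Rightarrow> real^'n \<Rightarrow> real^'n^'m" where
  "rank_one w x = (\<chi> i j. w $ i * x $ j)"

lemma rank_one_mult: "rank_one w x *v y = (x \<bullet> y) *\<^sub>R w"
  by (simp add: rank_one_def vec_eq_iff matrix_vector_mult_def inner_vec_def
      sum_distrib_left mult_ac)

lemma mult_rank_one: "w v* rank_one u x = (w \<bullet> u) *\<^sub>R x"
  by (simp add: rank_one_def vec_eq_iff vector_matrix_mult_def inner_vec_def
      sum_distrib_right sum_distrib_left mult_ac)

lemma inner_rank_one: "rank_one w x \<bullet> H = w \<bullet> (H *v x)"
  by (simp add: rank_one_def inner_vec_def matrix_vector_mult_def sum_distrib_left mult_ac)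

text \<open>Along any line in one of the three arguments the loss is a quadratic polynomial in the
  line parameter, so minimality kills its linear coefficient.  For \<open>A\<close> this uses that the
  Frobenius norm is the norm of \<^typ>\<open>real^'n^'n\<close> as an inner product space, in which \<open>rank_one\<close>
  represents the functional \<open>H \<mapsto> w \<bullet> (H *v x)\<close>.\<close>

lemma minimizer_stationary:
  fixes S A :: "real^'n^'n"
  assumes min: "\<And>\<theta>' \<eta>' A'. loss S \<theta>0 \<mu> lam \<theta> \<eta> A \<le> loss S \<theta>0 \<mu> lam \<theta>' \<eta>' A'"
  shows "\<eta> - A *v \<theta> = S *v \<theta>0 - \<eta>"
    and "lam *\<^sub>R \<theta> = (\<eta> - A *v \<theta>) v* A"
    and "\<mu>\<^sup>2 *\<^sub>R (A - S) = rank_one (\<eta> - A *v \<theta>) \<theta>"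
proof -
  define r w where "r = S *v \<theta>0 - \<eta>" and "w = \<eta> - A *v \<theta>"
  have "(w - r) \<bullet> h = 0" for h
  proof (rule quadratic_nonneg_imp_linear_coeff_0)
    fix t :: real
    have "S *v \<theta>0 - (\<eta> + t *\<^sub>R h) = r + t *\<^sub>R (- h)"
      "(\<eta> + t *\<^sub>R h) - A *v \<theta> = w + t *\<^sub>R h"
      by (simp_all add: r_def w_def)
    note eqs = this
    have "loss S \<theta>0 \<mu> lam \<theta> (\<eta> + t *\<^sub>R h) A - loss S \<theta>0 \<mu> lam \<theta> \<eta> A
        = (w - r) \<bullet> h * t + (norm h)\<^sup>2 * t\<^sup>2"
      unfolding loss_def eqs norm_sq_along_line r_def[symmetric] w_def[symmetric]
      by (simp add: inner_diff_left algebra_simps)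
    then show "0 \<le> (w - r) \<bullet> h * t + (norm h)\<^sup>2 * t\<^sup>2"
      using min[of \<theta> "\<eta> + t *\<^sub>R h" A] by linarith
  qed
  from this[of "w - r"] show "\<eta> - A *v \<theta> = S *v \<theta>0 - \<eta>"
    by (simp only: inner_eq_zero_iff right_minus_eq r_def w_def)
  have "(lam *\<^sub>R \<theta> - w v* A) \<bullet> h = 0" for h
  proof (rule quadratic_nonneg_imp_linear_coeff_0)
    fix t :: real
    let ?q = "(norm (A *v h))\<^sup>2 / 2 + lam / 2 * (norm h)\<^sup>2"
    have "\<eta> - A *v (\<theta> + t *\<^sub>R h) = w + t *\<^sub>R (- (A *v h))"
      by (simp add: w_def matrix_vector_right_distrib matrix_vector_mult_scaleR)
    note eqs = this
    have "loss S \<theta>0 \<mu> lam (\<theta> + t *\<^sub>R h) \<eta> A - loss S \<theta>0 \<mu> lam \<theta> \<eta> A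
        = (lam *\<^sub>R \<theta> - w v* A) \<bullet> h * t + ?q * t\<^sup>2"
      unfolding loss_def eqs norm_sq_along_line w_def[symmetric]
      by (simp add: inner_diff_left dot_lmul_matrix algebra_simps)
    then show "0 \<le> (lam *\<^sub>R \<theta> - w v* A) \<bullet> h * t + ?q * t\<^sup>2"
      using min[of "\<theta> + t *\<^sub>R h" \<eta> A] by linarith
  qed
  from this[of "lam *\<^sub>R \<theta> - w v* A"] show "lam *\<^sub>R \<theta> = (\<eta> - A *v \<theta>) v* A"
    by (simp only: inner_eq_zero_iff right_minus_eq w_def)
  have "(\<mu>\<^sup>2 *\<^sub>R (A - S) - rank_one w \<theta>) \<bullet> H = 0" for H
  proof (rule quadratic_nonneg_imp_linear_coeff_0)
    fix t :: real
    let ?q = "(norm (H *v \<theta>))\<^sup>2 / 2 + \<mu>\<^sup>2 / 2 * (norm H)\<^sup>2"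
    have "\<eta> - (A + t *\<^sub>R H) *v \<theta> = w + t *\<^sub>R (- (H *v \<theta>))"
      "S - (A + t *\<^sub>R H) = (S - A) + t *\<^sub>R (- H)"
      by (simp_all add: w_def matrix_vector_mult_add_rdistrib scaleR_matrix_vector_assoc)
    note eqs = this
    have "loss S \<theta>0 \<mu> lam \<theta> \<eta> (A + t *\<^sub>R H) - loss S \<theta>0 \<mu> lam \<theta> \<eta> A
        = (\<mu>\<^sup>2 *\<^sub>R (A - S) - rank_one w \<theta>) \<bullet> H * t + ?q * t\<^sup>2"
      unfolding loss_def frob_norm_eq_norm eqs norm_sq_along_line w_def[symmetric]
      by (simp add: inner_diff_left inner_rank_one algebra_simps)
    then show "0 \<le> (\<mu>\<^sup>2 *\<^sub>R (A - S) - rank_one w \<theta>) \<bullet> H * t + ?q * t\<^sup>2"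
      using min[of \<theta> \<eta> "A + t *\<^sub>R H"] by linarith
  qed
  from this[of "\<mu>\<^sup>2 *\<^sub>R (A - S) - rank_one w \<theta>"]
  show "\<mu>\<^sup>2 *\<^sub>R (A - S) = rank_one (\<eta> - A *v \<theta>) \<theta>"
    by (simp only: inner_eq_zero_iff right_minus_eq w_def)
qed

text \<open>At the competitor \<open>(\<theta>0, S *v \<theta>0, S)\<close> every term of the loss but the ridge penalty
  vanishes.\<close>

lemma minimizer_norm_le:
  fixes S A :: "real^'n^'n"
  assumes "lam > 0"
    and min: "\<And>\<theta>' \<eta>' A'. loss S \<theta>0 \<mu> lam \<theta> \<eta> A \<le> loss S \<theta>0 \<mu> lam \<theta>' \<eta>' A'"
  shows "norm \<theta> \<le> norm \<theta>0"
proof -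
  have "lam / 2 * (norm \<theta>)\<^sup>2 \<le> loss S \<theta>0 \<mu> lam \<theta> \<eta> A"
    by (simp add: loss_def)
  also have "\<dots> \<le> loss S \<theta>0 \<mu> lam \<theta>0 (S *v \<theta>0) S"
    by (rule min)
  also have "\<dots> = lam / 2 * (norm \<theta>0)\<^sup>2"
    by (simp add: loss_def frob_norm_eq_norm)
  finally show ?thesis
    using \<open>lam > 0\<close> by (simp add: power_mono_iff)
qed

text \<open>With the residual \<open>w = \<eta> - A *v \<theta>\<close>, the condition for \<open>A\<close> says that
  \<open>A = S + w \<theta>\<^sup>T / \<mu>\<^sup>2\<close>.  Then \<open>A *v \<theta>\<close> is \<open>S *v \<theta>\<close> plus a multiple of \<open>w\<close>, so the condition
  for \<open>\<eta>\<close> becomes \<open>w = - g * S (\<theta> - \<theta>0)\<close> with a scalar \<open>g\<close>, and the condition for \<open>\<theta>\<close> involves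
  \<open>\<theta>\<close> alone.\<close>

lemma profile_stationarity:
  fixes S A :: "real^'n^'n"
  assumes "transpose S = S" "\<mu> > 0"
    and min: "\<And>\<theta>' \<eta>' A'. loss S \<theta>0 \<mu> lam \<theta> \<eta> A \<le> loss S \<theta>0 \<mu> lam \<theta>' \<eta>' A'"
  defines "g \<equiv> 1 / (2 + (norm \<theta>)\<^sup>2 / \<mu>\<^sup>2)"
  shows "lam *\<^sub>R \<theta> = - g *\<^sub>R (S *v (S *v (\<theta> - \<theta>0)))
           + (g\<^sup>2 * (norm (S *v (\<theta> - \<theta>0)))\<^sup>2 / \<mu>\<^sup>2) *\<^sub>R \<theta>"
proof -
  define w where "w = \<eta> - A *v \<theta>"
  have w1: "w = S *v \<theta>0 - \<eta>" and w2: "lam *\<^sub>R \<theta> = w v* A"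
    and w3: "\<mu>\<^sup>2 *\<^sub>R (A - S) = rank_one w \<theta>"
    using minimizer_stationary[OF min] by (simp_all add: w_def)
  have "A - S = (1 / \<mu>\<^sup>2) *\<^sub>R (\<mu>\<^sup>2 *\<^sub>R (A - S))"
    using \<open>\<mu> > 0\<close> by simp
  then have A: "A = S + (1 / \<mu>\<^sup>2) *\<^sub>R rank_one w \<theta>"
    unfolding w3 by (simp add: algebra_simps)
  have A\<theta>: "A *v \<theta> = S *v \<theta> + ((norm \<theta>)\<^sup>2 / \<mu>\<^sup>2) *\<^sub>R w"
    by (simp add: A matrix_vector_mult_add_rdistrib rank_one_mult power2_norm_eq_inner
        flip: scaleR_matrix_vector_assoc)
  have "2 *\<^sub>R w = S *v \<theta>0 - A *v \<theta>"
    using arg_cong2[OF w1 w_def, of "(+)"] by (simp add: scaleR_2)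
  then have "(2 + (norm \<theta>)\<^sup>2 / \<mu>\<^sup>2) *\<^sub>R w = - (S *v (\<theta> - \<theta>0))"
    unfolding A\<theta> by (simp add: algebra_simps)
  moreover have "g * (2 + (norm \<theta>)\<^sup>2 / \<mu>\<^sup>2) = 1"
    unfolding g_def by (simp add: add_pos_nonneg less_imp_neq[symmetric])
  ultimately have "1 *\<^sub>R w = g *\<^sub>R - (S *v (\<theta> - \<theta>0))"
    by (metis scaleR_scaleR)
  then have w: "w = - g *\<^sub>R (S *v (\<theta> - \<theta>0))"
    by simp
  have "lam *\<^sub>R \<theta> = transpose A *v w"
    by (simp add: w2)
  also have "transpose A = S + (1 / \<mu>\<^sup>2) *\<^sub>R transpose (rank_one w \<theta>)"
    using \<open>transpose S = S\<close> by (simp add: A transpose_def vec_eq_iff)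
  also have "\<dots> *v w = S *v w + ((norm w)\<^sup>2 / \<mu>\<^sup>2) *\<^sub>R \<theta>"
    by (simp add: matrix_vector_mult_add_rdistrib mult_rank_one power2_norm_eq_inner
        flip: scaleR_matrix_vector_assoc)
  finally show ?thesis
    unfolding w matrix_vector_mult_scaleR by (simp add: power_mult_distrib)
qed

section \<open>The ridge resolvent\<close>

lemma symmetric_matrix_inner:
  fixes S :: "real^'n^'n"
  assumes "transpose S = S"
  shows "x \<bullet> (S *v y) = (S *v x) \<bullet> y"
  using assms by (metis dot_lmul_matrix transpose_matrix_vector)

lemma norm_mult_le_op_norm: "norm (A *v x) \<le> op_norm A * norm x"
  unfolding op_norm_def by (rule onorm) simp

lemma op_norm_nonneg: "0 \<le> op_norm A"
  unfolding op_norm_def by (rule onorm_pos_le) simp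

lemma ridge_mult:
  fixes S :: "real^'n^'n"
  shows "((1/2) *\<^sub>R (S ** S) + lam *\<^sub>R mat 1) *v x = (1/2) *\<^sub>R (S *v (S *v x)) + lam *\<^sub>R x"
  by (simp add: matrix_vector_mult_add_rdistrib matrix_vector_mul_assoc
      flip: scaleR_matrix_vector_assoc)

lemma ridge_solution_norm_le:
  fixes S :: "real^'n^'n"
  assumes "transpose S = S" "lam > 0"
    and eq: "(1/2) *\<^sub>R (S *v (S *v x)) + lam *\<^sub>R x = z"
  shows "norm x \<le> norm z / lam"
proof -
  have "lam * (norm x)\<^sup>2 \<le> (norm (S *v x))\<^sup>2 / 2 + lam * (norm x)\<^sup>2"
    by simp
  also have "\<dots> = x \<bullet> z"
    by (simp add: symmetric_matrix_inner[OF assms(1)] inner_add_right power2_norm_eq_inner flip: eq)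
  also have "\<dots> \<le> norm x * norm z"
    by (rule norm_cauchy_schwarz)
  finally have "norm x * (lam * norm x) \<le> norm x * norm z"
    by (simp add: power2_eq_square algebra_simps)
  then have "norm x = 0 \<or> lam * norm x \<le> norm z"
    by (metis mult_le_cancel_left_pos norm_ge_zero order_le_less)
  then show ?thesis
    using \<open>lam > 0\<close> by (auto simp: field_simps)
qed

text \<open>Here \<open>x = e - p\<close> with \<open>p = lam * M\<^sup>-\<^sup>1 e\<close>, where \<open>M = S\<^sup>2 / 2 + lam * I\<close>.  Pairing
  \<open>M p = lam * e\<close> with \<open>p\<close> gives \<open>\<parallel>p\<parallel>\<^sup>2 \<le> p \<bullet> e\<close>: the vector \<open>p\<close> lies in the ball with diameter
  from \<open>0\<close> to \<open>e\<close>, and therefore so does its reflection \<open>e - p\<close>.\<close>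

lemma ridge_shrinkage_norm_le:
  fixes S :: "real^'n^'n"
  assumes "transpose S = S" "lam > 0"
    and eq: "(1/2) *\<^sub>R (S *v (S *v x)) + lam *\<^sub>R x = (1/2) *\<^sub>R (S *v (S *v e))"
  shows "norm x \<le> norm e"
proof -
  define p where "p = e - x"
  have x: "x = e - p" by (simp add: p_def)
  have "lam *\<^sub>R e = (1/2) *\<^sub>R (S *v (S *v p)) + lam *\<^sub>R p"
    using eq by (simp add: p_def matrix_vector_mult_diff_distrib algebra_simps)
  then have "p \<bullet> (lam *\<^sub>R e) = (norm (S *v p))\<^sup>2 / 2 + lam * (norm p)\<^sup>2"
    by (simp add: symmetric_matrix_inner[OF assms(1)] inner_add_right power2_norm_eq_inner)
  then have "lam * (norm p)\<^sup>2 \<le> lam * (p \<bullet> e)"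
    by simp
  then have *: "(norm p)\<^sup>2 \<le> p \<bullet> e"
    using \<open>lam > 0\<close> by simp
  have "(norm x)\<^sup>2 = (norm e)\<^sup>2 - 2 * (p \<bullet> e) + (norm p)\<^sup>2"
    by (simp add: x power2_norm_eq_inner inner_diff_left inner_diff_right inner_commute)
  also have "\<dots> \<le> (norm e)\<^sup>2"
    using * zero_le_power2[of "norm p"] by linarith
  finally show ?thesis
    by (simp add: power_mono_iff)
qed

lemma ridge_inverse:
  fixes S :: "real^'n^'n"
  assumes "transpose S = S" "lam > 0"
  defines "M \<equiv> (1/2) *\<^sub>R (S ** S) + lam *\<^sub>R mat 1"
  shows "M *v (matrix_inv M *v z) = z"
proof -
  have "x = 0" if "M *v x = 0" for x
    using ridge_solution_norm_le[OF assms(1,2), of x 0] that by (simp add: M_def ridge_mult)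
  then have "invertible M"
    by (simp add: invertible_left_inverse matrix_left_invertible_ker)
  then have "M ** matrix_inv M = mat 1"
    unfolding invertible_def matrix_inv_def by (rule someI2_ex) auto
  then show ?thesis
    by (simp add: matrix_vector_mul_assoc)
qed

lemma ridge_bias_equation:
  fixes S :: "real^'n^'n" and \<theta>0 :: "real^'n"
  assumes "transpose S = S" "lam > 0"
  defines "b \<equiv> bias S \<theta>0 lam"
  shows "(1/2) *\<^sub>R (S *v (S *v b)) + lam *\<^sub>R b = - lam *\<^sub>R \<theta>0"
  unfolding ridge_mult[symmetric]
  by (simp only: b_def bias_def matrix_vector_mult_scaleR ridge_inverse[OF assms(1,2)])

text \<open>The two parts of the right-hand side are treated differently on purpose: bounding the
  \<open>S\<^sup>2\<close> part through \<open>\<parallel>M\<^sup>-\<^sup>1\<parallel> \<le> 1 / lam\<close> as well would cost a factor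
  \<open>\<parallel>S\<parallel>\<^sup>2 / lam\<close>.\<close>

lemma ridge_perturbation_norm_le:
  fixes S :: "real^'n^'n"
  assumes "transpose S = S" "lam > 0" "0 \<le> \<alpha>"
    and eq: "(1/2) *\<^sub>R (S *v (S *v x)) + lam *\<^sub>R x = \<alpha> *\<^sub>R ((1/2) *\<^sub>R (S *v (S *v e))) + z"
  shows "norm x \<le> \<alpha> * norm e + norm z / lam"
proof -
  define y where "y = matrix_inv ((1/2) *\<^sub>R (S ** S) + lam *\<^sub>R mat 1) *v ((1/2) *\<^sub>R (S *v (S *v e)))"
  have y: "(1/2) *\<^sub>R (S *v (S *v y)) + lam *\<^sub>R y = (1/2) *\<^sub>R (S *v (S *v e))"
    unfolding ridge_mult[symmetric] y_def ridge_inverse[OF assms(1,2)] ..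
  have "(1/2) *\<^sub>R (S *v (S *v (x - \<alpha> *\<^sub>R y))) + lam *\<^sub>R (x - \<alpha> *\<^sub>R y)
      = ((1/2) *\<^sub>R (S *v (S *v x)) + lam *\<^sub>R x) - \<alpha> *\<^sub>R ((1/2) *\<^sub>R (S *v (S *v y)) + lam *\<^sub>R y)"
    by (simp add: matrix_vector_mult_diff_distrib matrix_vector_mult_scaleR algebra_simps)
  also have "\<dots> = z"
    unfolding eq y by simp
  finally have "norm (x - \<alpha> *\<^sub>R y) \<le> norm z / lam"
    by (rule ridge_solution_norm_le[OF assms(1,2)])
  moreover have "norm (\<alpha> *\<^sub>R y) \<le> \<alpha> * norm e"
    using ridge_shrinkage_norm_le[OF assms(1,2) y] \<open>0 \<le> \<alpha>\<close> by (simp add: mult_left_mono)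
  ultimately show ?thesis
    using norm_triangle_sub[of x "\<alpha> *\<^sub>R y"] by linarith
qed

section \<open>Comparison with the ridge solution\<close>

text \<open>The first term on the right measures how far the profile weight \<open>g\<close> is from \<open>1/2\<close>, the
  second is the contribution of its derivative; see the introduction.  The bound is stated in
  terms of \<open>\<theta> - \<theta>0\<close>, which is itself at most the bias plus the deviation being
  estimated.\<close>

lemma deviation_self_bound:
  fixes S A :: "real^'n^'n"
  assumes sym: "transpose S = S" and pos: "\<mu> > 0" "lam > 0"
    and min: "\<And>\<theta>' \<eta>' A'. loss S \<theta>0 \<mu> lam \<theta> \<eta> A \<le> loss S \<theta>0 \<mu> lam \<theta>' \<eta>' A'"
  shows "norm (\<theta> - \<theta>0 - bias S \<theta>0 lam)
    \<le> (norm \<theta>0)\<^sup>2 / (2 * \<mu>\<^sup>2) * norm (\<theta> - \<theta>0)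
      + (op_norm S)\<^sup>2 * norm \<theta>0 / (4 * \<mu>\<^sup>2 * lam) * (norm (\<theta> - \<theta>0))\<^sup>2"
proof -
  define e b where "e = \<theta> - \<theta>0" and "b = bias S \<theta>0 lam"
  define s where "s = (norm \<theta>)\<^sup>2 / \<mu>\<^sup>2"
  define g where "g = 1 / (2 + s)"
  define c where "c = g\<^sup>2 * (norm (S *v e))\<^sup>2 / \<mu>\<^sup>2"
  have s: "0 \<le> s" by (simp add: s_def)
  have g: "0 \<le> g" "g \<le> 1/2" "1 - 2 * g \<le> s / 2"
    using s by (auto simp: g_def field_simps)
  have \<theta>_le: "norm \<theta> \<le> norm \<theta>0"
    using minimizer_norm_le[OF pos(2) min] .
  have st: "lam *\<^sub>R \<theta> = - g *\<^sub>R (S *v (S *v e)) + c *\<^sub>R \<theta>"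
    using profile_stationarity[OF sym pos(1) min] by (simp add: g_def s_def c_def e_def)
  have b: "(1/2) *\<^sub>R (S *v (S *v b)) + lam *\<^sub>R b = - lam *\<^sub>R \<theta>0"
    using ridge_bias_equation[OF sym pos(2)] by (simp add: b_def)
  have "(1/2) *\<^sub>R (S *v (S *v (e - b))) + lam *\<^sub>R (e - b)
      = (1/2) *\<^sub>R (S *v (S *v e)) + lam *\<^sub>R e - ((1/2) *\<^sub>R (S *v (S *v b)) + lam *\<^sub>R b)"
    by (simp add: matrix_vector_mult_diff_distrib algebra_simps)
  also have "\<dots> = (1/2) *\<^sub>R (S *v (S *v e)) + lam *\<^sub>R \<theta>"
    unfolding b by (simp add: e_def algebra_simps)
  also have "\<dots> = (1 - 2 * g) *\<^sub>R ((1/2) *\<^sub>R (S *v (S *v e))) + c *\<^sub>R \<theta>"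
    unfolding st by (simp add: algebra_simps)
  finally have *: "norm (e - b) \<le> (1 - 2 * g) * norm e + norm (c *\<^sub>R \<theta>) / lam"
    using g by (intro ridge_perturbation_norm_le[OF sym pos(2)]) auto
  have "s \<le> (norm \<theta>0)\<^sup>2 / \<mu>\<^sup>2"
    unfolding s_def using \<theta>_le by (intro divide_right_mono power_mono) auto
  then have "1 - 2 * g \<le> (norm \<theta>0)\<^sup>2 / (2 * \<mu>\<^sup>2)"
    using g(3) by (simp add: field_simps)
  then have 1: "(1 - 2 * g) * norm e \<le> (norm \<theta>0)\<^sup>2 / (2 * \<mu>\<^sup>2) * norm e"
    by (rule mult_right_mono) simp
  have "c \<le> (1/2)\<^sup>2 * (op_norm S * norm e)\<^sup>2 / \<mu>\<^sup>2"
    unfolding c_def using g norm_mult_le_op_norm[of S e]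
    by (intro divide_right_mono mult_mono power_mono) auto
  moreover have "0 \<le> c" by (simp add: c_def)
  ultimately have "norm (c *\<^sub>R \<theta>) \<le> (1/2)\<^sup>2 * (op_norm S * norm e)\<^sup>2 / \<mu>\<^sup>2 * norm \<theta>0"
    using \<theta>_le unfolding norm_scaleR by (intro mult_mono) auto
  then have 2: "norm (c *\<^sub>R \<theta>) / lam \<le> (1/2)\<^sup>2 * (op_norm S * norm e)\<^sup>2 / \<mu>\<^sup>2 * norm \<theta>0 / lam"
    using pos by (intro divide_right_mono) auto
  also have "\<dots> = (op_norm S)\<^sup>2 * norm \<theta>0 / (4 * \<mu>\<^sup>2 * lam) * (norm e)\<^sup>2"
    by (simp add: power_mult_distrib power2_eq_square)
  finally show ?thesis
    using * 1 unfolding e_def b_def by linarith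
qed

theorem theorem2p3:
  fixes S :: "real^'n^'n" and \<theta>0 \<theta>s \<eta>s :: "real^'n" and As :: "real^'n^'n"
    and \<mu> lam :: real
  assumes "sym_psd S"
    and "\<mu> > 0" and "lam > 0"
    and "norm \<theta>0 \<le> \<mu> / 420"
    and "norm \<theta>0 * op_norm S \<le> \<mu> * sqrt lam / 168"
    and "is_arg_min (\<lambda>(\<theta>, \<eta>, A). loss S \<theta>0 \<mu> lam \<theta> \<eta> A) (\<lambda>_. True) (\<theta>s, \<eta>s, As)"
  shows "norm (\<theta>s - \<theta>0 - bias S \<theta>0 lam)
         \<le> 210 * (norm \<theta>0 / \<mu> + op_norm S * norm (bias S \<theta>0 lam) / (\<mu> * sqrt lam))
             * norm (bias S \<theta>0 lam)"
proof -
  define b e where "b = bias S \<theta>0 lam" and "e = \<theta>s - \<theta>0"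
  define x where "x = norm \<theta>0 / \<mu>"
  define k where "k = op_norm S / (\<mu> * sqrt lam)"
  have sym: "transpose S = S"
    using assms(1) by (simp add: sym_psd_def)
  have min: "loss S \<theta>0 \<mu> lam \<theta>s \<eta>s As \<le> loss S \<theta>0 \<mu> lam \<theta>' \<eta>' A'" for \<theta>' \<eta>' A'
    using assms(6) by (force simp: is_arg_min_def not_less)
  have x: "0 \<le> x" "x \<le> 1 / 420"
    using assms(2,4) by (auto simp: x_def field_simps)
  have k: "0 \<le> k" "k * norm \<theta>0 \<le> 1 / 168"
    using assms(2,3,5) op_norm_nonneg[of S] by (auto simp: k_def field_simps)
  have xsq: "x\<^sup>2 \<le> 1 / 2"
    by (rule order_trans[OF power_mono[OF x(2,1)]]) (simp add: power2_eq_square)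
  have "0 \<le> k * norm \<theta>0"
    using k by simp
  then have ksq: "(k * norm \<theta>0)\<^sup>2 \<le> 1 / 2"
    by (rule order_trans[OF power_mono[OF k(2)]]) (simp add: power2_eq_square)
  have "k\<^sup>2 = (op_norm S)\<^sup>2 / (\<mu>\<^sup>2 * lam)"
    using assms(3) by (simp add: k_def power_divide power_mult_distrib)
  then have self: "norm (e - b) \<le> x\<^sup>2 / 2 * norm e + k\<^sup>2 * norm \<theta>0 / 4 * (norm e)\<^sup>2"
    using deviation_self_bound[OF sym assms(2,3) min]
    by (simp add: x_def e_def b_def power_divide mult_ac)
  have tri: "norm e \<le> norm b + norm (e - b)"
    using norm_triangle_sub[of e b] by simp
  have e_le: "norm e \<le> 2 * norm \<theta>0"
    using norm_triangle_ineq4[of \<theta>s \<theta>0] minimizer_norm_le[OF assms(3) min]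
    by (simp add: e_def)
  \<comment> \<open>the crude bound \<open>e_le\<close> on one factor \<open>norm e\<close> makes the self-bound linear in the other,
    with coefficient at most 1/2, so that the deviation can be absorbed\<close>
  have "k\<^sup>2 * norm \<theta>0 / 4 * (norm e)\<^sup>2 \<le> k\<^sup>2 * norm \<theta>0 / 4 * (norm e * (2 * norm \<theta>0))"
    unfolding power2_eq_square[of "norm e"] using e_le by (intro mult_left_mono) auto
  also have "\<dots> = (k * norm \<theta>0)\<^sup>2 / 2 * norm e"
    by (simp add: power2_eq_square)
  also have "\<dots> \<le> 1 / 4 * norm e"
    using ksq by (intro mult_right_mono) auto
  finally have "norm (e - b) \<le> x\<^sup>2 / 2 * norm e + 1 / 4 * norm e"
    using self by linarith
  moreover have "x\<^sup>2 / 2 * norm e \<le> 1 / 4 * norm e"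
    using xsq by (intro mult_right_mono) auto
  ultimately have e2: "norm e \<le> 2 * norm b"
    using tri by linarith
  \<comment> \<open>second pass through the self-bound, now keeping the small factors \<open>x\<close> and \<open>k * norm b\<close>\<close>
  have "x\<^sup>2 / 2 * norm e \<le> x / 2 * (2 * norm b)"
    using x e2 by (intro mult_mono) (auto simp: power2_eq_square mult_left_le)
  moreover have "k\<^sup>2 * norm \<theta>0 / 4 * (norm e)\<^sup>2 \<le> k * norm b * norm b"
  proof -
    have "k\<^sup>2 * norm \<theta>0 / 4 * (norm e)\<^sup>2 \<le> k\<^sup>2 * norm \<theta>0 / 4 * (2 * norm b)\<^sup>2"
      using e2 by (intro mult_left_mono power_mono) auto
    also have "\<dots> = (k * norm \<theta>0) * (k * norm b * norm b)"
      by (simp add: power2_eq_square)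
    also have "\<dots> \<le> 1 * (k * norm b * norm b)"
      using k by (intro mult_right_mono) auto
    finally show ?thesis by simp
  qed
  ultimately have "norm (e - b) \<le> (x + k * norm b) * norm b"
    using self by (simp add: algebra_simps)
  also have "\<dots> \<le> 210 * (x + k * norm b) * norm b"
    using x k by (intro mult_right_mono) auto
  finally show ?thesis
    by (simp add: x_def k_def e_def b_def)
qed

end
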